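(* Let $d,n\geq 1$ and let $p_1,\ldots,p_n$ and $q_1,\ldots,q_n$ be vectors in $\mathbb{R}^d$. Let $\bar{p}=\frac{1}{n}\sum_{i=1}^n p_i$, $\bar{q}=\frac{1}{n}\sum_{i=1}^n q_i$, and let $r_i=p_i-\bar{p}$, $s_i=q_i-\bar{q}$ for $i=1,\ldots,n$. Let $\hat{U}$ be a $d\times d$ rotation matrix such that $U=\hat{U}$ minimizes $\sum_{i=1}^n\|Us_i-r_i\|^2$ over all $d\times d$ rotation matrices $U$. Let $\hat{t}=\bar{p}-\hat{U}\bar{q}$, and let $\hat{\phi}:\mathbb{R}^d\to\mathbb{R}^d$ be given by $\hat{\phi}(q)=\hat{U}q+\hat{t}$ for $q\in\mathbb{R}^d$. Then $\phi=\hat{\phi}$ minimizes $\sum_{i=1}^n\|\phi(q_i)-p_i\|^2$ over all orientation-preserving rigid motions $\phi$ of $\mathbb{R}^d$.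
   Context: All matrices are real, and $\|\cdot\|$ denotes the Euclidean norm on $\mathbb{R}^d$. A rotation matrix is an orthogonal matrix of determinant $1$. A rigid motion of $\mathbb{R}^d$ is a map $\phi:\mathbb{R}^d\to\mathbb{R}^d$ of the form $\phi(q)=Uq+t$ for $q\in\mathbb{R}^d$, where $U$ is a $d\times d$ orthogonal matrix and $t\in\mathbb{R}^d$; it is orientation preserving if $\det(U)=1$. *)

theory Defs
  imports "HOL-Analysis.Analysis"
begin

definition orientation_preserving_rigid_motion :: "(real^'d \<Rightarrow> real^'d) \<Rightarrow> bool" where
  "orientation_preserving_rigid_motion \<phi> \<longleftrightarrow>
     (\<exists>U t. orthogonal_matrix U \<and> det U = 1 \<and> (\<forall>q. \<phi> q = U *v q + t))"

end

theory Submission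
  imports Defs
begin

text \<open>
  For a fixed linear part the optimal translation matches the centroids, whatever that linear part
  is. Indeed, for \<open>\<phi> x = U x + t\<close> the residual \<open>\<phi> (q i) - p i\<close> is the centered residual
  \<open>U (s i) - r i\<close> plus the constant vector \<open>c = \<phi> qbar - pbar\<close>. The centered residuals sum to
  zero, so the cross terms in the sum of squares cancel and the cost of \<open>\<phi>\<close> is the centered cost
  of \<open>U\<close> plus \<open>n\<close> times the squared norm of \<open>c\<close> (lemma \<open>rigid_cost_decomposition\<close>). The
  choice \<open>t = pbar - U qbar\<close> makes the second term vanish, and the first one involves only the
  rotation, so minimizing it over rotations minimizes the whole cost.
\<close>

lemma sum_centered_eq_0:
  fixes x :: "nat \<Rightarrow> 'a::real_vector"
  assumes "n \<ge> 1"
  shows "(\<Sum>i=1..n. x i - (1 / real n) *\<^sub>R (\<Sum>j=1..n. x j)) = 0"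
  using assms by (simp add: sum_subtractf sum_constant_scaleR)

text \<open>
  This is the parallel axis theorem: the cross term is twice the inner product of \<open>c\<close> with
  \<open>sum v A\<close>, which vanishes.
\<close>

lemma sum_norm_shift_sq:
  fixes v :: "'i \<Rightarrow> 'a::real_inner"
  assumes "sum v A = 0"
  shows "(\<Sum>i\<in>A. (norm (v i + c))\<^sup>2) = (\<Sum>i\<in>A. (norm (v i))\<^sup>2) + real (card A) * (norm c)\<^sup>2"
proof -
  have "(\<Sum>i\<in>A. (norm (v i + c))\<^sup>2)
      = (\<Sum>i\<in>A. (norm (v i))\<^sup>2 + 2 * (v i \<bullet> c) + (norm c)\<^sup>2)"
    by (simp add: power2_norm_eq_inner inner_add_left inner_add_right inner_commute algebra_simps)
  also have "\<dots> = (\<Sum>i\<in>A. (norm (v i))\<^sup>2) + 2 * (sum v A \<bullet> c) + real (card A) * (norm c)\<^sup>2"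
    by (simp add: sum.distrib inner_sum_left sum_distrib_left)
  finally show ?thesis
    using assms by simp
qed

lemma rigid_cost_decomposition:
  fixes p q :: "nat \<Rightarrow> real^'d" and U :: "real^'d^'d"
  assumes "n \<ge> 1"
    and pbar: "pbar = (1 / real n) *\<^sub>R (\<Sum>i=1..n. p i)"
    and qbar: "qbar = (1 / real n) *\<^sub>R (\<Sum>i=1..n. q i)"
  shows "(\<Sum>i=1..n. (norm (U *v q i + t - p i))\<^sup>2)
    = (\<Sum>i=1..n. (norm (U *v (q i - qbar) - (p i - pbar)))\<^sup>2)
      + real n * (norm (U *v qbar + t - pbar))\<^sup>2"
proof -
  define v where "v i = U *v (q i - qbar) - (p i - pbar)" for i
  define c where "c = U *v qbar + t - pbar"
  have "(\<Sum>i=1..n. v i) = U *v (\<Sum>i=1..n. q i - qbar) - (\<Sum>i=1..n. p i - pbar)"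
    unfolding v_def sum_subtractf[of "\<lambda>i. U *v (q i - qbar)"]
    by (simp only: linear_sum[OF matrix_vector_mul_linear])
  also have "\<dots> = 0"
    unfolding pbar qbar by (simp only: sum_centered_eq_0[OF \<open>n \<ge> 1\<close>]) simp
  finally have v0: "(\<Sum>i=1..n. v i) = 0" .
  have shift: "U *v q i + t - p i = v i + c" for i
    by (simp add: v_def c_def matrix_vector_mult_diff_distrib)
  show ?thesis
    unfolding shift sum_norm_shift_sq[OF v0] by (simp add: v_def c_def)
qed

theorem corollary1:
  fixes n :: nat
    and p q r s :: "nat \<Rightarrow> real^'d"
    and pbar qbar that :: "real^'d"
    and Uhat :: "real^'d^'d"
    and phihat :: "real^'d \<Rightarrow> real^'d"
  assumes "n \<ge> 1"
    and "pbar = (1 / real n) *\<^sub>R (\<Sum>i=1..n. p i)"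
    and "qbar = (1 / real n) *\<^sub>R (\<Sum>i=1..n. q i)"
    and "\<And>i. i \<in> {1..n} \<Longrightarrow> r i = p i - pbar"
    and "\<And>i. i \<in> {1..n} \<Longrightarrow> s i = q i - qbar"
    and "is_arg_min (\<lambda>U. \<Sum>i=1..n. (norm (U *v s i - r i))\<^sup>2) rotation_matrix Uhat"
    and "that = pbar - Uhat *v qbar"
    and "\<And>x. phihat x = Uhat *v x + that"
  shows "is_arg_min (\<lambda>\<phi>. \<Sum>i=1..n. (norm (\<phi> (q i) - p i))\<^sup>2)
           orientation_preserving_rigid_motion phihat"
proof -
  define C where "C U = (\<Sum>i=1..n. (norm (U *v s i - r i))\<^sup>2)" for U
  have cost: "(\<Sum>i=1..n. (norm (U *v q i + t - p i))\<^sup>2)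
      = C U + real n * (norm (U *v qbar + t - pbar))\<^sup>2" for U t
    unfolding C_def rigid_cost_decomposition[OF assms(1-3)] by (simp add: assms(4,5))
  have rot: "rotation_matrix Uhat" and min: "\<And>U. rotation_matrix U \<Longrightarrow> C Uhat \<le> C U"
    using assms(6) by (auto simp: is_arg_min_linorder C_def)
  have "orientation_preserving_rigid_motion phihat"
    using rot assms(8) by (auto simp: orientation_preserving_rigid_motion_def rotation_matrix_def)
  moreover have "(\<Sum>i=1..n. (norm (phihat (q i) - p i))\<^sup>2) \<le> (\<Sum>i=1..n. (norm (\<phi> (q i) - p i))\<^sup>2)"
    if "orientation_preserving_rigid_motion \<phi>" for \<phi>
  proof -
    obtain U t where U: "rotation_matrix U" and \<phi>: "\<And>x. \<phi> x = U *v x + t"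
      using \<open>orientation_preserving_rigid_motion \<phi>\<close>
      by (auto simp: orientation_preserving_rigid_motion_def rotation_matrix_def)
    have "(\<Sum>i=1..n. (norm (phihat (q i) - p i))\<^sup>2) = C Uhat"
      unfolding assms(8) cost by (simp add: assms(7))
    also have "\<dots> \<le> C U"
      by (rule min[OF U])
    also have "\<dots> \<le> (\<Sum>i=1..n. (norm (\<phi> (q i) - p i))\<^sup>2)"
      unfolding \<phi> cost by simp
    finally show ?thesis .
  qed
  ultimately show ?thesis
    by (simp add: is_arg_min_linorder)
qed

end
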